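(* The algorithmic traversal of a (nonempty) wellordered connected graph $(V,E,<)$ is lexicographically least amongst all wellordered traversals of $(V,E)$.
   Context: A wellordered connected graph $(V,E,<)$ is a (possibly infinite) connected undirected graph $(V,E)$ together with a wellordering $<$ of $V$. A traversal of $(V,E)$ is a linear ordering of $V$ all of whose initial segments (downward closed subsets) induce connected subgraphs; it is wellordered if it is a wellordering. Deterministic graph search on $(V,E,<)$ defines sets $S_\alpha\subseteq V$ by transfinite recursion: $S_0=\emptyset$; $S_1=\{v_0\}$, where $v_0$ is the $<$-least element of $V$; for $\beta\ge 1$, $S_{\beta+1}$ is obtained from $S_\beta$ by adding the $<$-least element of $\{v\in V\setminus S_\beta:\exists w\in S_\beta\ E(w,v)\}$ if this set is nonempty, and $S_{\beta+1}=S_\beta$ otherwise; and $S_\alpha=\bigcup_{\beta<\alpha}S_\beta$ at limit $\alpha$. Every vertex eventually enters some $S_\alpha$. The algorithmic traversal is the wellordering $\prec$ of $V$ given by $v\prec w$ iff the least $\alpha$ with $v\in S_\alpha$ is less than the least $\alpha$ with $w\in S_\alpha$; it is a traversal of $(V,E)$. A wellordering of $V$ is identified with the order-enumerating bijection $t:\alpha\to V$ from an ordinal $\alpha$. For two distinct wellorderings $t_1,t_2$ of $V$, $t_1$ is lexicographically prior to $t_2$ if $t_1(\beta)<t_2(\beta)$, where $\beta$ is the least ordinal $\gamma$ with $t_1(\gamma)\ne t_2(\gamma)$. *)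

theory Defs
  imports Main
begin

section \<open>Ordinals\<close>

unbundle cardinal_syntax

text \<open>
  The type \<open>'a ordinal\<close> consists of the order types of the wellorderings of subsets of
  \<open>'a + nat\<close>, i.e. of all ordinals of cardinality at most that of \<open>'a\<close> or of the natural
  numbers.  It contains the order type of every wellordering of a set of elements of \<open>'a\<close>,
  is closed under successors, and does not inject into \<open>'a\<close>; hence a transfinite recursion
  that produces subsets of \<open>'a\<close> and is indexed by \<open>'a ordinal\<close> is as long as is ever needed.
  The summand \<open>nat\<close> only serves to provide enough ordinals if \<open>'a\<close> is finite.
\<close>

quotient_type 'a ordinal =
  "('a + nat) rel" / partial: "\<lambda>r s. Well_order r \<and> Well_order s \<and> r =o s"
proof (rule part_equivpI)
  have "Well_order ({} :: ('a + nat) rel)"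
    by simp
  then show "\<exists>r :: ('a + nat) rel. Well_order r \<and> Well_order r \<and> r =o r"
    using ordIso_reflexive by blast
  show "symp (\<lambda>r s :: ('a + nat) rel. Well_order r \<and> Well_order s \<and> r =o s)"
    by (auto intro!: sympI dest: ordIso_symmetric)
  show "transp (\<lambda>r s :: ('a + nat) rel. Well_order r \<and> Well_order s \<and> r =o s)"
    by (auto intro!: transpI dest: ordIso_transitive)
qed

lemma ordinal_exhaust:
  obtains r :: "('a + nat) rel" where "Well_order r" "x = abs_ordinal r"
  by (induction x rule: ordinal.abs_induct) blast

instantiation ordinal :: (type) wellorder
begin

lift_definition less_eq_ordinal :: "'a ordinal \<Rightarrow> 'a ordinal \<Rightarrow> bool"
  is "\<lambda>r s. r \<le>o s"
  by (meson ordIso_ordLeq_trans ordLeq_ordIso_trans ordIso_symmetric)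

lift_definition less_ordinal :: "'a ordinal \<Rightarrow> 'a ordinal \<Rightarrow> bool"
  is "\<lambda>r s. r <o s"
  by (meson ordIso_ordLess_trans ordLess_ordIso_trans ordIso_symmetric)

lemma abs_ordinal_less_iff:
  fixes r s :: "('a + nat) rel"
  assumes "Well_order r" "Well_order s"
  shows "abs_ordinal r < abs_ordinal s \<longleftrightarrow> r <o s"
  by (rule less_ordinal.abs_eq) (use assms in \<open>simp_all add: ordIso_reflexive\<close>)

instance
proof
  fix x y z :: "'a ordinal"
  show "x < y \<longleftrightarrow> x \<le> y \<and> \<not> y \<le> x"
    by transfer (use not_ordLess_ordLeq not_ordLeq_iff_ordLess ordLess_imp_ordLeq in blast)
  show "x \<le> x"
    by transfer (simp add: ordLeq_reflexive)
  show "x \<le> y \<Longrightarrow> y \<le> z \<Longrightarrow> x \<le> z"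
    by transfer (rule ordLeq_transitive)
  show "x \<le> y \<Longrightarrow> y \<le> x \<Longrightarrow> x = y"
    by transfer (simp add: ordIso_iff_ordLeq)
  show "x \<le> y \<or> y \<le> x"
    by transfer (simp add: ordLeq_total)
next
  fix P :: "'a ordinal \<Rightarrow> bool" and a :: "'a ordinal"
  assume step: "\<And>x. (\<And>y. y < x \<Longrightarrow> P y) \<Longrightarrow> P x"
  have "\<forall>x. x = abs_ordinal r \<and> Well_order r \<longrightarrow> P x" for r :: "('a + nat) rel"
  proof (induction r rule: wf_induct_rule[OF wf_ordLess])
    case (1 r)
    show ?case
    proof (intro allI impI, elim conjE)
      fix x :: "'a ordinal"
      assume x: "x = abs_ordinal r" and r: "Well_order r"
      show "P x"
      proof (rule step)
        fix y :: "'a ordinal"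
        assume "y < x"
        obtain s where s: "Well_order s" "y = abs_ordinal s"
          by (rule ordinal_exhaust)
        have "s <o r"
          using \<open>y < x\<close> by (simp add: x s r abs_ordinal_less_iff)
        with 1 s show "P y"
          by blast
      qed
    qed
  qed
  then show "P a"
    using ordinal_exhaust[of a] by metis
qed

end

instantiation ordinal :: (type) zero
begin

lift_definition zero_ordinal :: "'a ordinal" is "{} :: ('a + nat) rel"
  by (simp add: ordIso_reflexive)

instance ..

end

lemma ordinal_zero_le: "0 \<le> (x :: 'a ordinal)"
proof transfer
  fix r :: "('a + nat) rel"
  assume "Well_order r \<and> Well_order r \<and> r =o r"
  then show "{} \<le>o r"
    by (subst not_ordLess_iff_ordLeq[symmetric]) (simp_all add: ordLess_iff_ordIso_Restr)
qed

lemma ordinal_no_max: "\<exists>\<gamma>. \<beta> < (\<gamma> :: 'a ordinal)"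
proof -
  obtain r :: "('a + nat) rel" where r: "Well_order r" "\<beta> = abs_ordinal r"
    by (rule ordinal_exhaust)
  define f :: "'a + nat \<Rightarrow> 'a + nat" where "f = map_sum id Suc"
  define r' where "r' = dir_image r f"
  define x :: "'a + nat" where "x = Inr 0"
  define s where "s = r' \<union> Field r' \<times> {x} \<union> {(x, x)}"
  have inj: "inj_on f (Field r)"
    unfolding f_def by (rule inj_on_subset[OF sum.inj_map]) auto
  have r': "Well_order r'"
    unfolding r'_def using r(1) inj by (rule Well_order_dir_image)
  have x: "x \<notin> Field r'"
    unfolding r'_def dir_image_Field x_def f_def
    by (auto simp: map_sum_def split: sum.splits)
  have lin: "Linear_order r'" and wf: "wf (r' - Id)"
    using r' by (simp_all add: well_order_on_def)
  have Field_s: "Field s = insert x (Field r')"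
    unfolding s_def by (auto simp: Field_def)
  have "Linear_order s"
  proof -
    have F: "a \<in> Field r' \<and> b \<in> Field r'" if "(a, b) \<in> r'" for a b
      using that by (auto simp: Field_def)
    have R: "refl_on (Field r') r'" "trans r'" "antisym r'" "total_on (Field r') r'"
      using lin by (auto simp: linear_order_on_def partial_order_on_def preorder_on_def)
    have "refl_on (insert x (Field r')) s"
      using R(1) by (auto simp: refl_on_def s_def)
    moreover have "s \<subseteq> insert x (Field r') \<times> insert x (Field r')"
      using F by (auto simp: s_def)
    moreover have "trans s"
    proof (rule transI)
      fix a b c assume "(a, b) \<in> s" "(b, c) \<in> s"
      then show "(a, c) \<in> s"
        using F x transD[OF R(2)] unfolding s_def by blast
    qed
    moreover have "antisym s"
    proof (rule antisymI)
      fix a b assume "(a, b) \<in> s" "(b, a) \<in> s"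
      then show "a = b"
        using F x antisymD[OF R(3)] unfolding s_def by blast
    qed
    moreover have "total_on (insert x (Field r')) s"
      using R(4) by (auto simp: total_on_def s_def)
    ultimately show ?thesis
      by (simp add: linear_order_on_def partial_order_on_def preorder_on_def Field_s)
  qed
  moreover have "wf (s - Id)"
  proof -
    have "s - Id = (r' - Id) \<union> Field r' \<times> {x}"
      using x by (auto simp: s_def)
    moreover have "wf (Field r' \<times> {x})"
    proof (rule wfI_min)
      fix a Q
      assume a: "a \<in> (Q :: ('a + nat) set)"
      show "\<exists>z\<in>Q. \<forall>y. (y, z) \<in> Field r' \<times> {x} \<longrightarrow> y \<notin> Q"
      proof (cases "\<exists>z\<in>Q. z \<noteq> x")
        case True
        then show ?thesis by blast
      next
        case False
        then show ?thesis using a x by (metis SigmaD1)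
      qed
    qed
    ultimately show ?thesis
      using wf x by (auto intro!: wf_Un simp: Field_def)
  qed
  ultimately have s: "Well_order s"
    by (simp add: well_order_on_def)
  have "underS s x = Field r'"
    using x by (auto simp: underS_def s_def Field_def)
  then have "Restr s (underS s x) = r'"
    using x by (auto simp: s_def Field_def)
  with r' s have "r' <o s"
    by (subst ordLess_iff_ordIso_Restr)
       (auto simp: Field_s intro!: bexI[of _ x] ordIso_reflexive)
  then have "r <o s"
    using dir_image_ordIso[OF r(1) inj] ordIso_ordLess_trans
    unfolding r'_def by blast
  then have "\<beta> < abs_ordinal s"
    using r s by (simp add: abs_ordinal_less_iff)
  then show ?thesis ..
qed

definition osuc :: "'a ordinal \<Rightarrow> 'a ordinal"
  where "osuc \<beta> = (LEAST \<gamma>. \<beta> < \<gamma>)"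

lemma osuc_greater: "\<beta> < osuc \<beta>"
  unfolding osuc_def using ordinal_no_max by (rule LeastI_ex)

lemma osuc_le_iff: "osuc \<beta> \<le> \<gamma> \<longleftrightarrow> \<beta> < \<gamma>"
  by (metis Least_le osuc_def osuc_greater order_less_le_trans)

lemma osuc_inject: "osuc \<beta> = osuc \<gamma> \<longleftrightarrow> \<beta> = \<gamma>"
  by (metis linorder_neq_iff osuc_greater osuc_le_iff not_le)

definition opred :: "'a ordinal \<Rightarrow> 'a ordinal"
  where "opred \<alpha> = (THE \<beta>. \<alpha> = osuc \<beta>)"

lemma opred_osuc [simp]: "opred (osuc \<beta>) = \<beta>"
  by (simp add: opred_def osuc_inject)

definition limit_ordinal :: "'a ordinal \<Rightarrow> bool"
  where "limit_ordinal \<alpha> \<longleftrightarrow> \<alpha> \<noteq> 0 \<and> (\<nexists>\<beta>. \<alpha> = osuc \<beta>)"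


section \<open>Graphs, traversals and wellorderings\<close>

text \<open>
  A vertex set, an adjacency relation and a wellordering.  As in \<^const>\<open>well_order_on\<close>, linear
  orderings are given by their reflexive relations.
\<close>

definition undirected_graph :: "'a set \<Rightarrow> 'a rel \<Rightarrow> bool"
  where "undirected_graph V E \<longleftrightarrow> E \<subseteq> V \<times> V \<and> sym E"

text \<open>The subgraph induced by \<open>S\<close> is connected; this includes the empty subgraph.\<close>

definition induces_connected :: "'a rel \<Rightarrow> 'a set \<Rightarrow> bool"
  where "induces_connected E S \<longleftrightarrow> (\<forall>u\<in>S. \<forall>v\<in>S. (u, v) \<in> (E \<inter> S \<times> S)\<^sup>*)"

definition wellordered_connected_graph :: "'a set \<Rightarrow> 'a rel \<Rightarrow> 'a rel \<Rightarrow> bool"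
  where "wellordered_connected_graph V E R \<longleftrightarrow>
    undirected_graph V E \<and> induces_connected E V \<and> well_order_on V R"

definition traversal :: "'a set \<Rightarrow> 'a rel \<Rightarrow> 'a rel \<Rightarrow> bool"
  where "traversal V E T \<longleftrightarrow>
    linear_order_on V T \<and> (\<forall>I. ofilter T I \<longrightarrow> induces_connected E I)"

definition wellordered_traversal :: "'a set \<Rightarrow> 'a rel \<Rightarrow> 'a rel \<Rightarrow> bool"
  where "wellordered_traversal V E T \<longleftrightarrow> traversal V E T \<and> well_order_on V T"


section \<open>Deterministic graph search\<close>

definition search_frontier :: "'a set \<Rightarrow> 'a rel \<Rightarrow> 'a set \<Rightarrow> 'a set"
  where "search_frontier V E S = {v \<in> V - S. \<exists>w\<in>S. (w, v) \<in> E}"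

function search_stage :: "'a set \<Rightarrow> 'a rel \<Rightarrow> 'a rel \<Rightarrow> 'a ordinal \<Rightarrow> 'a set" where
  "search_stage V E R \<alpha> =
    (if \<alpha> = 0 then {}
     else if limit_ordinal \<alpha> then (\<Union>\<beta>\<in>{..<\<alpha>}. search_stage V E R \<beta>)
     else if opred \<alpha> = 0 then {wo_rel.minim R V}
     else
       (let S = search_stage V E R (opred \<alpha>) in
        if search_frontier V E S \<noteq> {} then insert (wo_rel.minim R (search_frontier V E S)) S else S))"
  by auto
termination
proof (relation "inv_image {(\<alpha>, \<beta>). \<alpha> < \<beta>} (\<lambda>(V, E, R, \<alpha>). \<alpha>)", goal_cases)
  case 1
  show ?case
    by (intro wf_inv_image wf)
next
  case 2
  then show ?case
    by simp
next
  case 3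
  then show ?case
    by (auto simp: limit_ordinal_def osuc_greater)
qed

declare search_stage.simps [simp del]

lemma osuc_nonzero: "osuc \<beta> \<noteq> 0"
  using osuc_greater[of \<beta>] ordinal_zero_le[of \<beta>] by auto

lemma search_stage_zero: "search_stage V E R 0 = {}"
  by (simp add: search_stage.simps)

lemma search_stage_one: "search_stage V E R (osuc 0) = {wo_rel.minim R V}"
  by (subst search_stage.simps) (auto simp: limit_ordinal_def osuc_nonzero)

lemma search_stage_osuc:
  assumes "\<beta> \<noteq> 0"
  shows "search_stage V E R (osuc \<beta>) =
    (if search_frontier V E (search_stage V E R \<beta>) \<noteq> {}
     then insert (wo_rel.minim R (search_frontier V E (search_stage V E R \<beta>))) (search_stage V E R \<beta>)
     else search_stage V E R \<beta>)"
  using assms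
  by (subst search_stage.simps) (auto simp: limit_ordinal_def osuc_nonzero Let_def)

lemma search_stage_limit:
  assumes "limit_ordinal \<alpha>"
  shows "search_stage V E R \<alpha> = (\<Union>\<beta>\<in>{..<\<alpha>}. search_stage V E R \<beta>)"
  using assms by (subst search_stage.simps) (auto simp: limit_ordinal_def)

definition entry_time :: "'a set \<Rightarrow> 'a rel \<Rightarrow> 'a rel \<Rightarrow> 'a \<Rightarrow> 'a ordinal"
  where "entry_time V E R v = (LEAST \<alpha>. v \<in> search_stage V E R \<alpha>)"

definition algorithmic_traversal :: "'a set \<Rightarrow> 'a rel \<Rightarrow> 'a rel \<Rightarrow> 'a rel"
  where "algorithmic_traversal V E R =
    {(v, w) \<in> V \<times> V. v = w \<or> entry_time V E R v < entry_time V E R w}"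


section \<open>The lexicographic ordering of wellorderings\<close>

text \<open>\<open>t\<close>, restricted to the ordinals below \<open>\<alpha>\<close>, is the enumeration of \<open>V\<close> in the order \<open>T\<close>.\<close>

definition enumerates :: "'a set \<Rightarrow> 'a rel \<Rightarrow> 'a ordinal \<Rightarrow> ('a ordinal \<Rightarrow> 'a) \<Rightarrow> bool"
  where "enumerates V T \<alpha> t \<longleftrightarrow>
    bij_betw t {..<\<alpha>} V \<and> (\<forall>\<beta><\<alpha>. \<forall>\<gamma><\<alpha>. \<beta> \<le> \<gamma> \<longleftrightarrow> (t \<beta>, t \<gamma>) \<in> T)"

definition lex_prior :: "'a set \<Rightarrow> 'a rel \<Rightarrow> 'a rel \<Rightarrow> 'a rel \<Rightarrow> bool"
  where "lex_prior V R T\<^sub>1 T\<^sub>2 \<longleftrightarrow>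
    (\<exists>\<alpha>\<^sub>1 t\<^sub>1 \<alpha>\<^sub>2 t\<^sub>2. enumerates V T\<^sub>1 \<alpha>\<^sub>1 t\<^sub>1 \<and> enumerates V T\<^sub>2 \<alpha>\<^sub>2 t\<^sub>2 \<and>
      (\<exists>\<beta>. \<beta> < \<alpha>\<^sub>1 \<and> \<beta> < \<alpha>\<^sub>2 \<and> (\<forall>\<gamma><\<beta>. t\<^sub>1 \<gamma> = t\<^sub>2 \<gamma>) \<and>
        t\<^sub>1 \<beta> \<noteq> t\<^sub>2 \<beta> \<and> (t\<^sub>1 \<beta>, t\<^sub>2 \<beta>) \<in> R))"

end

theory Submission
  imports Defs
begin

text \<open>
  If a proper subset \<open>S\<close> of \<open>V\<close> is an initial segment of a traversal and \<open>v\<close> is the vertex that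
  comes right after it, then \<open>S\<close> and \<open>insert v S\<close> are both connected, so \<open>v\<close> is adjacent to
  \<open>S\<close> unless \<open>S\<close> is empty.  Hence after \<open>S\<close> a wellordered traversal can only continue with an
  element of the set called \<open>search_candidates V E S\<close> below, and the search always chooses the
  \<open>R\<close>-least one.  At the first place where another wellordered traversal differs from the
  algorithmic one, the segments before it agree, so both choose from the same set of candidates
  and the algorithmic traversal has the smaller choice (\<open>algorithmic_next_least\<close> and
  \<open>traversal_next_candidate\<close>).

  Two facts about ordinals make this precise.  Every wellordering of a set of elements of \<open>'a\<close> is
  enumerated by a member of \<open>'a ordinal\<close> (\<open>enumeration_exists\<close>), so that \<open>first_difference\<close>
  can speak of the first place where two wellorderings differ.  Moreover \<open>'a ordinal\<close> does not
  inject into \<open>'a\<close> (\<open>no_injection_of_ordinals\<close>): a search that never reached some vertex would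
  find a new vertex at every stage, which is such an injection.  So every vertex is reached
  (\<open>search_exhaustive\<close>), its entry time is a successor ordinal, and the proper initial
  segments of the algorithmic traversal are search stages, which are connected.
\<close>

section \<open>Ordinals and enumerations\<close>

lemma less_osuc_iff: "\<beta> < osuc \<gamma> \<longleftrightarrow> \<beta> \<le> \<gamma>"
  by (metis osuc_le_iff not_le)

lemma ordinal_zero_osuc_limit:
  obtains "\<gamma> = 0" | \<delta> where "\<gamma> = osuc \<delta>" | "limit_ordinal \<gamma>"
  unfolding limit_ordinal_def by blast

lemma well_order_on_pullback:
  fixes g :: "'b \<Rightarrow> 'c::wellorder"
  assumes "inj_on g A"
  shows "well_order_on A {(v, w) \<in> A \<times> A. g v \<le> g w}" (is "well_order_on A ?r")
proof -
  have "refl_on A ?r" "?r \<subseteq> A \<times> A" "trans ?r" "total_on A ?r"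
    by (auto simp: refl_on_def trans_def total_on_def)
  moreover have "antisym ?r"
    using inj_onD[OF assms] by (intro antisymI) auto
  moreover have "wf (?r - Id)"
  proof (rule wf_subset)
    show "wf (inv_image {(x, y). x < y} g)"
      by (intro wf_inv_image wf)
    show "?r - Id \<subseteq> inv_image {(x, y). x < y} g"
    proof
      fix x assume "x \<in> ?r - Id"
      then obtain v w where "x = (v, w)" "v \<in> A" "w \<in> A" "g v \<le> g w" "v \<noteq> w"
        by blast
      then show "x \<in> inv_image {(x, y). x < y} g"
        using assms by (simp add: in_inv_image order_less_le inj_on_eq_iff)
    qed
  qed
  ultimately show ?thesis
    by (simp add: well_order_on_def linear_order_on_def partial_order_on_def preorder_on_def)
qed

text \<open>
  The inverse of the enumeration sends \<open>v\<close> to the order type of the elements before \<open>v\<close>; it is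
  onto the ordinals below the order type of \<open>T\<close> since a smaller wellordering is isomorphic to a
  proper initial segment.
\<close>

lemma enumeration_exists:
  fixes V :: "'a set"
  assumes T: "well_order_on V T"
  shows "\<exists>\<alpha> t. enumerates V T \<alpha> t"
proof -
  define r :: "('a + nat) rel" where "r = dir_image T Inl"
  have VT: "Field T = V"
    using well_order_on_Well_order[OF T] by simp
  have r: "Well_order r"
    unfolding r_def using T VT by (auto intro!: Well_order_dir_image)
  have Fr: "Field r = Inl ` V"
    by (simp add: r_def dir_image_Field VT)
  have wo: "wo_rel r"
    using r by (simp add: wo_rel_def)
  define seg where "seg x = Restr r (underS r x)" for x
  define rank :: "'a \<Rightarrow> 'a ordinal" where "rank v = abs_ordinal (seg (Inl v))" for v
  have seg: "Well_order (seg x)" for x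
    unfolding seg_def using r by (rule Well_order_Restr)
  have r_iff: "(Inl v, Inl w) \<in> r \<longleftrightarrow> (v, w) \<in> T" for v w
    by (auto simp: r_def dir_image_def)
  have less: "rank v < rank w" if "(v, w) \<in> T" "v \<noteq> w" for v w
  proof -
    have "Inl v \<in> underS r (Inl w)"
      using that r_iff by (simp add: underS_def)
    moreover have "Inl v \<notin> underS r (Inl v)"
      by (simp add: underS_def)
    moreover have "underS r (Inl v) \<subseteq> underS r (Inl w)"
      using that r_iff by (intro underS_incr wo_rel.TRANS[OF wo] wo_rel.ANTISYM[OF wo]) simp
    ultimately have "underS r (Inl v) \<subset> underS r (Inl w)"
      by blast
    then have "seg (Inl v) <o seg (Inl w)"
      unfolding seg_def
      using ofilter_subset_ordLess[OF r wo_rel.underS_ofilter[OF wo] wo_rel.underS_ofilter[OF wo]]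
      by blast
    then show ?thesis
      by (simp add: rank_def abs_ordinal_less_iff seg)
  qed
  have total: "v = w \<or> (v, w) \<in> T \<or> (w, v) \<in> T" if "v \<in> V" "w \<in> V" for v w
    using T that unfolding well_order_on_def linear_order_on_def total_on_def by blast
  have refl: "(v, v) \<in> T" if "v \<in> V" for v
    using T that
    unfolding well_order_on_def linear_order_on_def partial_order_on_def preorder_on_def refl_on_def
    by blast
  have le_iff: "rank v \<le> rank w \<longleftrightarrow> (v, w) \<in> T" if "v \<in> V" "w \<in> V" for v w
    using less[of v w] less[of w v] total[OF that] refl[OF that(1)] by fastforce
  have inj: "inj_on rank V"
    using less total by (metis inj_onI less_irrefl)
  have img: "rank ` V = {..<abs_ordinal r}"
  proof (intro equalityI subsetI)
    fix x assume "x \<in> rank ` V"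
    then obtain v where v: "v \<in> V" "x = rank v" by blast
    have "seg (Inl v) <o r"
      unfolding ordLess_iff_ordIso_Restr[OF r seg] using v seg
      by (auto simp: Fr seg_def intro!: ordIso_reflexive)
    then show "x \<in> {..<abs_ordinal r}"
      by (simp add: v rank_def abs_ordinal_less_iff seg r)
  next
    fix x assume x: "x \<in> {..<abs_ordinal r}"
    obtain s where s: "Well_order s" "x = abs_ordinal s"
      by (rule ordinal_exhaust)
    have "s <o r"
      using x s by (simp add: abs_ordinal_less_iff r)
    then obtain v where v: "v \<in> V" "s =o seg (Inl v)"
      unfolding ordLess_iff_ordIso_Restr[OF r s(1)] seg_def Fr by blast
    then have "x = rank v"
      unfolding s(2) rank_def by (intro Quotient3_rel_abs[OF Quotient3_ordinal]) (simp add: s seg)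
    with v show "x \<in> rank ` V" by blast
  qed
  define t where "t = inv_into V rank"
  have bij: "bij_betw t {..<abs_ordinal r} V"
    unfolding t_def using inj img by (intro bij_betw_inv_into) (simp add: bij_betw_def)
  have rank_t: "rank (t \<beta>) = \<beta>" "t \<beta> \<in> V" if "\<beta> < abs_ordinal r" for \<beta>
    using that img unfolding t_def by (auto intro!: f_inv_into_f inv_into_into)
  have "enumerates V T (abs_ordinal r) t"
    unfolding enumerates_def using bij rank_t le_iff by metis
  then show ?thesis by blast
qed

text \<open>
  An injection would transfer the wellordering of all ordinals to a set of elements of \<open>'a\<close>,
  whose order type is again an ordinal \<open>\<alpha>\<close>.  The resulting embedding of the ordinals into those
  below \<open>\<alpha>\<close> would send \<open>\<alpha>\<close> below itself.
\<close>

lemma no_injection_of_ordinals: "\<not> inj (f :: 'a ordinal \<Rightarrow> 'a)"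
proof
  assume f: "inj f"
  define T where "T = {(v, w) \<in> range f \<times> range f. inv f v \<le> inv f w}"
  have "well_order_on (range f) T"
    unfolding T_def by (intro well_order_on_pullback inj_on_inv_into) simp
  then obtain \<alpha> :: "'a ordinal" and t where t: "enumerates (range f) T \<alpha> t"
    using enumeration_exists by blast
  define h where "h x = inv_into {..<\<alpha>} t (f x)" for x
  have bij: "bij_betw t {..<\<alpha>} (range f)"
    using t by (simp add: enumerates_def)
  have h: "h x < \<alpha>" "t (h x) = f x" for x
    using bij_betw_inv_into_right[OF bij, of "f x"]
      bij_betw_apply[OF bij_betw_inv_into[OF bij], of "f x"]
    by (auto simp: h_def)
  have h_le: "h x \<le> h y \<longleftrightarrow> x \<le> y" for x y
  proof -
    have "h x \<le> h y \<longleftrightarrow> (f x, f y) \<in> T"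
      using t h unfolding enumerates_def by metis
    then show ?thesis
      by (simp add: T_def f)
  qed
  have "x \<le> h x" for x
  proof (induction x rule: less_induct)
    case (less x)
    show ?case
    proof (rule ccontr)
      assume "\<not> x \<le> h x"
      then have "h x < x" by simp
      then have "h x \<le> h (h x)" using less by blast
      then show False using \<open>\<not> x \<le> h x\<close> h_le by blast
    qed
  qed
  then show False
    using h(1)[of \<alpha>] by (simp add: leD)
qed

text \<open>
  Neither of two distinct enumerations of the same set can extend the other, so they differ at a
  place where both are defined.
\<close>

lemma first_difference:
  fixes V :: "'a set"
  assumes e: "enumerates V T\<^sub>1 \<alpha>\<^sub>1 t\<^sub>1" "enumerates V T\<^sub>2 \<alpha>\<^sub>2 t\<^sub>2"
    and sub: "T\<^sub>1 \<subseteq> V \<times> V" "T\<^sub>2 \<subseteq> V \<times> V" and ne: "T\<^sub>1 \<noteq> T\<^sub>2"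
  obtains \<beta> where "\<beta> < \<alpha>\<^sub>1" "\<beta> < \<alpha>\<^sub>2" "\<And>\<gamma>. \<gamma> < \<beta> \<Longrightarrow> t\<^sub>1 \<gamma> = t\<^sub>2 \<gamma>" "t\<^sub>1 \<beta> \<noteq> t\<^sub>2 \<beta>"
proof -
  have no_extension: "\<not> \<alpha> < \<alpha>'"
    if "enumerates V T \<alpha> t" "enumerates V T' \<alpha>' t'" "\<forall>\<gamma><\<alpha>. t \<gamma> = t' \<gamma>"
    for T T' t t' and \<alpha> \<alpha>' :: "'a ordinal"
  proof
    assume lt: "\<alpha> < \<alpha>'"
    have bij: "bij_betw t {..<\<alpha>} V" "bij_betw t' {..<\<alpha>'} V"
      using that by (simp_all add: enumerates_def)
    then have "t' \<alpha> \<in> t ` {..<\<alpha>}"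
      using lt by (simp add: bij_betw_apply bij_betw_imp_surj_on)
    then obtain \<delta> where \<delta>: "\<delta> < \<alpha>" "t' \<alpha> = t \<delta>" by blast
    then have "t' \<alpha> = t' \<delta>"
      using that(3) by simp
    then have "\<alpha> = \<delta>"
      using inj_onD[OF bij_betw_imp_inj_on[OF bij(2)]] lt \<delta>(1) by simp
    with \<delta>(1) show False by simp
  qed
  have "\<exists>\<beta>. \<beta> < \<alpha>\<^sub>1 \<and> \<beta> < \<alpha>\<^sub>2 \<and> t\<^sub>1 \<beta> \<noteq> t\<^sub>2 \<beta>"
  proof (rule ccontr)
    assume "\<not> ?thesis"
    then have agree: "t\<^sub>1 \<beta> = t\<^sub>2 \<beta>" if "\<beta> < \<alpha>\<^sub>1" "\<beta> < \<alpha>\<^sub>2" for \<beta>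
      using that by blast
    have eq: "\<alpha>\<^sub>1 = \<alpha>\<^sub>2"
    proof (rule linorder_cases)
      assume "\<alpha>\<^sub>1 < \<alpha>\<^sub>2"
      then show ?thesis
        using no_extension[OF e] agree order_less_trans by blast
    next
      assume "\<alpha>\<^sub>2 < \<alpha>\<^sub>1"
      then show ?thesis
        using no_extension[OF e(2,1)] agree order_less_trans by metis
    qed
    have "(v, w) \<in> T\<^sub>1 \<longleftrightarrow> (v, w) \<in> T\<^sub>2" if vw: "v \<in> V" "w \<in> V" for v w
    proof -
      have "t\<^sub>1 ` {..<\<alpha>\<^sub>1} = V"
        using e(1) by (simp add: enumerates_def bij_betw_imp_surj_on)
      then obtain \<beta> \<gamma> where \<beta>: "\<beta> < \<alpha>\<^sub>1" "v = t\<^sub>1 \<beta>" and \<gamma>: "\<gamma> < \<alpha>\<^sub>1" "w = t\<^sub>1 \<gamma>"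
        using vw by blast
      have "(t\<^sub>1 \<beta>, t\<^sub>1 \<gamma>) \<in> T\<^sub>1 \<longleftrightarrow> \<beta> \<le> \<gamma>"
        using e(1) \<beta>(1) \<gamma>(1) unfolding enumerates_def by blast
      moreover have "(t\<^sub>2 \<beta>, t\<^sub>2 \<gamma>) \<in> T\<^sub>2 \<longleftrightarrow> \<beta> \<le> \<gamma>"
        using e(2) \<beta>(1) \<gamma>(1) unfolding enumerates_def eq by blast
      ultimately show ?thesis
        using \<beta> \<gamma> agree eq by simp
    qed
    then have "T\<^sub>1 = T\<^sub>2"
      using sub by auto
    with ne show False ..
  qed
  then obtain \<beta> where \<beta>: "\<beta> < \<alpha>\<^sub>1" "\<beta> < \<alpha>\<^sub>2" "t\<^sub>1 \<beta> \<noteq> t\<^sub>2 \<beta>"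
    and least: "\<forall>\<gamma><\<beta>. \<not> (\<gamma> < \<alpha>\<^sub>1 \<and> \<gamma> < \<alpha>\<^sub>2 \<and> t\<^sub>1 \<gamma> \<noteq> t\<^sub>2 \<gamma>)"
    using exists_least_iff[of "\<lambda>\<beta>. \<beta> < \<alpha>\<^sub>1 \<and> \<beta> < \<alpha>\<^sub>2 \<and> t\<^sub>1 \<beta> \<noteq> t\<^sub>2 \<beta>"] by blast
  show thesis
  proof (rule that)
    show "t\<^sub>1 \<gamma> = t\<^sub>2 \<gamma>" if "\<gamma> < \<beta>" for \<gamma>
      using least that order_less_trans[OF that \<beta>(1)] order_less_trans[OF that \<beta>(2)] by blast
  qed (fact \<beta>)+
qed

lemma enumeration_segment:
  assumes e: "enumerates V T \<alpha> t" and \<beta>: "\<beta> < \<alpha>"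
  shows "t ` {..<\<beta>} = {v \<in> V. (t \<beta>, v) \<notin> T}"
proof (intro equalityI subsetI)
  fix v assume "v \<in> t ` {..<\<beta>}"
  then obtain \<gamma> where "\<gamma> < \<beta>" "v = t \<gamma>" by blast
  moreover have "\<gamma> < \<alpha>" using \<open>\<gamma> < \<beta>\<close> \<beta> by simp
  ultimately show "v \<in> {v \<in> V. (t \<beta>, v) \<notin> T}"
    using e \<beta> unfolding enumerates_def bij_betw_def by (auto simp: leD)
next
  fix v assume v: "v \<in> {v \<in> V. (t \<beta>, v) \<notin> T}"
  then obtain \<gamma> where "\<gamma> < \<alpha>" "v = t \<gamma>"
    using e unfolding enumerates_def bij_betw_def by auto
  moreover from this have "\<not> \<beta> \<le> \<gamma>"
    using v e \<beta> unfolding enumerates_def by blast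
  ultimately show "v \<in> t ` {..<\<beta>}" by auto
qed

section \<open>Connected vertex sets\<close>

lemma connected_crossing_edge:
  assumes "induces_connected E U" "S \<subseteq> U" "S \<noteq> {}" "S \<noteq> U"
  obtains w v where "w \<in> S" "v \<in> U - S" "(w, v) \<in> E"
proof -
  obtain a b where ab: "a \<in> S" "b \<in> U" "b \<notin> S"
    using assms by blast
  have "(a, b) \<in> (E \<inter> U \<times> U)\<^sup>*"
    using assms(1,2) ab unfolding induces_connected_def by blast
  then have "b \<in> S \<or> (\<exists>w\<in>S. \<exists>v\<in>U - S. (w, v) \<in> E)"
    by (induction rule: rtrancl_induct) (use ab in blast)+
  then show thesis
    using ab that by blast
qed

lemma connected_insert:
  assumes "sym E" "induces_connected E S" "w \<in> S" "(w, v) \<in> E"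
  shows "induces_connected E (insert v S)"
proof -
  let ?F = "E \<inter> insert v S \<times> insert v S"
  have sub: "(E \<inter> S \<times> S)\<^sup>* \<subseteq> ?F\<^sup>*"
    by (rule rtrancl_mono) blast
  have wv: "(w, v) \<in> ?F" "(v, w) \<in> ?F"
    using assms by (auto dest: symD)
  have "(x, w) \<in> ?F\<^sup>* \<and> (w, x) \<in> ?F\<^sup>*" if "x \<in> insert v S" for x
    using that assms(2,3) sub wv unfolding induces_connected_def by blast
  then show ?thesis
    unfolding induces_connected_def by (meson rtrancl_trans)
qed

lemma connected_Union_chain:
  assumes "\<And>S. S \<in> \<C> \<Longrightarrow> induces_connected E S"
    and "\<And>S S'. S \<in> \<C> \<Longrightarrow> S' \<in> \<C> \<Longrightarrow> S \<subseteq> S' \<or> S' \<subseteq> S"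
  shows "induces_connected E (\<Union>\<C>)"
  unfolding induces_connected_def
proof (intro ballI)
  fix u v assume "u \<in> \<Union>\<C>" "v \<in> \<Union>\<C>"
  then obtain S where S: "S \<in> \<C>" "u \<in> S" "v \<in> S"
    using assms(2) by blast
  then have "(u, v) \<in> (E \<inter> S \<times> S)\<^sup>*"
    using assms(1) unfolding induces_connected_def by blast
  moreover have "(E \<inter> S \<times> S)\<^sup>* \<subseteq> (E \<inter> \<Union>\<C> \<times> \<Union>\<C>)\<^sup>*"
    using S(1) by (intro rtrancl_mono) blast
  ultimately show "(u, v) \<in> (E \<inter> \<Union>\<C> \<times> \<Union>\<C>)\<^sup>*" by blast
qed

section \<open>Candidates for the next vertex\<close>

text \<open>
  Treating all of \<open>V\<close> as available from the empty set makes the first step of the search an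
  instance of the general step.
\<close>

definition search_candidates :: "'a set \<Rightarrow> 'a rel \<Rightarrow> 'a set \<Rightarrow> 'a set"
  where "search_candidates V E S = (if S = {} then V else search_frontier V E S)"

lemma search_candidates_subset: "search_candidates V E S \<subseteq> V - S"
  by (auto simp: search_candidates_def search_frontier_def)

text \<open>
  Adding \<open>t \<beta>\<close> to the segment before it gives another initial segment of \<open>T\<close>.  That one is
  connected, so it has an edge between its new element and the old ones.
\<close>

lemma traversal_next_candidate:
  assumes "wellordered_traversal V E T" "enumerates V T \<alpha> t" "\<beta> < \<alpha>"
  shows "t \<beta> \<in> search_candidates V E (t ` {..<\<beta>})"
proof -
  let ?I = "t ` {..<\<beta>}" and ?J = "t ` {..\<beta>}"
  have T: "well_order_on V T" and conn: "\<And>I. ofilter T I \<Longrightarrow> induces_connected E I"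
    using assms(1) by (auto simp: wellordered_traversal_def traversal_def)
  have V: "t \<beta> \<in> V"
    using assms(2,3) by (auto simp: enumerates_def bij_betw_def)
  have I: "?I = {v \<in> V. (t \<beta>, v) \<notin> T}"
    using assms(2,3) by (rule enumeration_segment)
  have "(t \<beta>, t \<beta>) \<in> T"
    using assms(2,3) unfolding enumerates_def by blast
  then have nI: "t \<beta> \<notin> ?I"
    using I by blast
  have J: "?J = insert (t \<beta>) ?I"
    by (auto simp: order_le_less)
  have VT: "Field T = V"
    using well_order_on_Well_order[OF T] by simp
  have "ofilter T ?J"
    unfolding ofilter_def
  proof (intro conjI ballI subsetI)
    show "x \<in> Field T" if "x \<in> ?J" for x
      using that V I J VT by auto
  next
    fix x y assume x: "x \<in> ?J" and "y \<in> under T x"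
    then have yx: "(y, x) \<in> T" and y: "y \<in> V"
      using VT by (auto simp: under_def Field_def)
    obtain \<gamma> where \<gamma>: "\<gamma> \<le> \<beta>" "x = t \<gamma>"
      using x by blast
    obtain \<delta> where \<delta>: "\<delta> < \<alpha>" "y = t \<delta>"
      using y assms(2) by (auto simp: enumerates_def bij_betw_def)
    have "\<gamma> < \<alpha>"
      using \<gamma> assms(3) by simp
    then have "\<delta> \<le> \<gamma>"
      using yx \<gamma> \<delta> assms(2) unfolding enumerates_def by blast
    then show "y \<in> ?J"
      using \<gamma> \<delta> by auto
  qed
  then have *: "induces_connected E (insert (t \<beta>) ?I)"
    using conn J by simp
  show ?thesis
  proof (cases "?I = {}")
    case True
    then show ?thesis
      using V by (simp add: search_candidates_def)
  next
    case False
    obtain w v where "w \<in> ?I" "v \<in> insert (t \<beta>) ?I - ?I" "(w, v) \<in> E"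
      by (rule connected_crossing_edge[OF * _ False]) (use nI in auto)
    then show ?thesis
      using False V nI by (auto simp: search_candidates_def search_frontier_def)
  qed
qed

section \<open>The stages of the search\<close>

locale search_graph =
  fixes V :: "'a set" and E R :: "'a rel"
  assumes graph: "wellordered_connected_graph V E R" and nonempty: "V \<noteq> {}"
begin

abbreviation stage :: "'a ordinal \<Rightarrow> 'a set"
  where "stage \<equiv> search_stage V E R"

abbreviation candidates :: "'a ordinal \<Rightarrow> 'a set"
  where "candidates \<beta> \<equiv> search_candidates V E (stage \<beta>)"

abbreviation entry :: "'a \<Rightarrow> 'a ordinal"
  where "entry \<equiv> entry_time V E R"

lemma symE: "sym E" and V_connected: "induces_connected E V" and R: "well_order_on V R"
  using graph by (auto simp: wellordered_connected_graph_def undirected_graph_def)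

lemma minim_candidate: "B \<subseteq> V \<Longrightarrow> B \<noteq> {} \<Longrightarrow> wo_rel.minim R B \<in> B"
  and minim_le_candidate: "B \<subseteq> V \<Longrightarrow> b \<in> B \<Longrightarrow> (wo_rel.minim R B, b) \<in> R"
  using well_order_on_Well_order[OF R] wo_rel.minim_in[of R B] wo_rel.minim_least[of R B b]
  by (auto simp: wo_rel_def)

lemma stage_mono: "\<beta> \<le> \<gamma> \<Longrightarrow> stage \<beta> \<subseteq> stage \<gamma>"
proof (induction \<gamma> arbitrary: \<beta> rule: less_induct)
  case (less \<gamma>)
  show ?case
  proof (cases \<gamma> rule: ordinal_zero_osuc_limit)
    case 1
    then show ?thesis
      using less.prems ordinal_zero_le[of \<beta>] by simp
  next
    case (2 \<delta>)
    have "stage \<delta> \<subseteq> stage \<gamma>"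
      by (cases "\<delta> = 0") (auto simp: 2 search_stage_zero search_stage_osuc)
    then show ?thesis
      using less.IH[of \<delta> \<beta>] less.prems 2
      by (metis less_osuc_iff order_le_less order_refl subset_trans)
  next
    case 3
    then show ?thesis
      using less.prems by (auto simp: search_stage_limit order_le_less)
  qed
qed

lemma stage_osuc:
  "stage (osuc \<beta>) = (if candidates \<beta> \<noteq> {}
     then insert (wo_rel.minim R (candidates \<beta>)) (stage \<beta>) else stage \<beta>)"
proof (cases "\<beta> = 0")
  case True
  then show ?thesis
    using nonempty by (simp add: search_candidates_def search_stage_zero search_stage_one)
next
  case False
  then have "osuc 0 \<le> \<beta>"
    using ordinal_zero_le[of \<beta>] by (simp add: osuc_le_iff order_less_le)
  then have "stage (osuc 0) \<subseteq> stage \<beta>"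
    by (rule stage_mono)
  then have "stage \<beta> \<noteq> {}"
    by (auto simp: search_stage_one)
  then show ?thesis
    using False by (simp add: search_stage_osuc search_candidates_def)
qed

lemma stage_subset: "stage \<gamma> \<subseteq> V"
proof (induction \<gamma> rule: less_induct)
  case (less \<gamma>)
  show ?case
  proof (cases \<gamma> rule: ordinal_zero_osuc_limit)
    case 1
    then show ?thesis by (simp add: search_stage_zero)
  next
    case (2 \<delta>)
    then show ?thesis
      using less[of \<delta>] minim_candidate[of "candidates \<delta>"] search_candidates_subset[of V E "stage \<delta>"]
      by (auto simp: stage_osuc osuc_greater)
  next
    case 3
    then show ?thesis
      using less by (auto simp: search_stage_limit)
  qed
qed

lemma stage_connected: "induces_connected E (stage \<gamma>)"
proof (induction \<gamma> rule: less_induct)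
  case (less \<gamma>)
  show ?case
  proof (cases \<gamma> rule: ordinal_zero_osuc_limit)
    case 1
    then show ?thesis by (simp add: search_stage_zero induces_connected_def)
  next
    case (2 \<delta>)
    let ?v = "wo_rel.minim R (candidates \<delta>)"
    have conn: "induces_connected E (stage \<delta>)"
      using less 2 osuc_greater by blast
    consider "candidates \<delta> = {}" | "stage \<delta> = {}" | "candidates \<delta> \<noteq> {}" "stage \<delta> \<noteq> {}"
      by blast
    then show ?thesis
    proof cases
      case 3
      have "?v \<in> candidates \<delta>"
        using 3(1) search_candidates_subset[of V E "stage \<delta>"] by (intro minim_candidate) auto
      then obtain w where "w \<in> stage \<delta>" "(w, ?v) \<in> E"
        using 3(2) by (auto simp: search_candidates_def search_frontier_def)
      then show ?thesis
        using connected_insert[OF symE conn] 2 3(1) by (simp add: stage_osuc)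
    qed (use conn in \<open>auto simp: 2 stage_osuc induces_connected_def\<close>)
  next
    case 3
    then have "stage \<gamma> = \<Union> (stage ` {..<\<gamma>})"
      by (rule search_stage_limit)
    then show ?thesis
      using less stage_mono
      by (auto intro!: connected_Union_chain) (meson linear subsetD)
  qed
qed

lemma candidates_nonempty: "stage \<beta> \<noteq> V \<Longrightarrow> candidates \<beta> \<noteq> {}"
proof (cases "stage \<beta> = {}")
  case False
  assume "stage \<beta> \<noteq> V"
  then obtain w v where "w \<in> stage \<beta>" "v \<in> V - stage \<beta>" "(w, v) \<in> E"
    using connected_crossing_edge[OF V_connected stage_subset False] by metis
  then show ?thesis
    using False by (auto simp: search_candidates_def search_frontier_def)
qed (use nonempty in \<open>simp add: search_candidates_def\<close>)

text \<open>
  As \<open>V\<close> is connected, the search can only stop once it has reached all of \<open>V\<close>; otherwise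
  each stage contributes a vertex of its own, and there are too many stages for that.
\<close>

lemma search_exhaustive:
  assumes "v \<in> V"
  shows "\<exists>\<alpha>. v \<in> stage \<alpha>"
proof (rule ccontr)
  assume "\<nexists>\<alpha>. v \<in> stage \<alpha>"
  then have cand: "candidates \<beta> \<noteq> {}" for \<beta>
    using assms candidates_nonempty by metis
  define f where "f \<beta> = wo_rel.minim R (candidates \<beta>)" for \<beta>
  have fresh: "f \<beta> \<notin> stage \<beta>" for \<beta>
    using minim_candidate[OF _ cand[of \<beta>]] search_candidates_subset[of V E "stage \<beta>"]
    unfolding f_def by blast
  have "f \<beta> \<in> stage (osuc \<beta>)" for \<beta>
    by (simp add: f_def stage_osuc cand)
  then have "f \<beta> \<in> stage \<gamma>" if "\<beta> < \<gamma>" for \<beta> \<gamma>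
    using that stage_mono[of "osuc \<beta>" \<gamma>] by (auto simp: osuc_le_iff)
  then have "f \<beta> \<noteq> f \<gamma>" if "\<beta> < \<gamma>" for \<beta> \<gamma>
    using that fresh by metis
  then have "inj f"
    by (metis injI linorder_neqE)
  then show False
    using no_injection_of_ordinals by blast
qed

lemma stage_iff_entry:
  assumes "v \<in> V"
  shows "v \<in> stage \<gamma> \<longleftrightarrow> entry v \<le> \<gamma>"
proof
  show "v \<in> stage \<gamma> \<Longrightarrow> entry v \<le> \<gamma>"
    unfolding entry_time_def by (rule Least_le)
  have "v \<in> stage (entry v)"
    unfolding entry_time_def using search_exhaustive[OF assms] by (rule LeastI_ex)
  then show "entry v \<le> \<gamma> \<Longrightarrow> v \<in> stage \<gamma>"
    using stage_mono[of "entry v" \<gamma>] by blast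
qed

text \<open>
  A limit stage contains only what earlier stages contain, so a vertex enters at a successor
  stage, as the vertex chosen there, and the preceding stage consists of the vertices that
  entered before.
\<close>

lemma entry_step:
  assumes "v \<in> V"
  obtains \<delta> where "entry v = osuc \<delta>" "candidates \<delta> \<noteq> {}" "v = wo_rel.minim R (candidates \<delta>)"
    "stage \<delta> = {w \<in> V. entry w < entry v}"
proof -
  have v: "v \<in> stage (entry v)"
    unfolding stage_iff_entry[OF assms] by (rule order_refl)
  have least: "v \<notin> stage \<beta>" if "\<beta> < entry v" for \<beta>
    unfolding stage_iff_entry[OF assms] using that by (simp only: not_le)
  show thesis
  proof (cases "entry v" rule: ordinal_zero_osuc_limit)
    case 1
    then show thesis
      using stage_iff_entry[OF assms, of 0] by (simp add: search_stage_zero)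
  next
    case (2 \<delta>)
    have "v \<in> stage (osuc \<delta>)" "v \<notin> stage \<delta>"
      using v least[of \<delta>] by (simp_all add: 2 osuc_greater)
    then have "candidates \<delta> \<noteq> {}" "v = wo_rel.minim R (candidates \<delta>)"
      by (auto simp: stage_osuc split: if_splits)
    moreover have "stage \<delta> = {w \<in> V. entry w < entry v}"
      using stage_iff_entry[of _ \<delta>] stage_subset[of \<delta>] unfolding 2 less_osuc_iff by blast
    ultimately show thesis
      by (rule that[OF 2])
  next
    case 3
    obtain \<beta> where "\<beta> < entry v" "v \<in> stage \<beta>"
      using v unfolding search_stage_limit[OF 3] by blast
    then show thesis
      using least by blast
  qed
qed

section \<open>The algorithmic traversal\<close>

lemma inj_entry: "inj_on entry V"
proof (rule inj_onI)
  fix v w assume "v \<in> V" "w \<in> V" and eq: "entry v = entry w"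
  obtain \<delta> where "entry v = osuc \<delta>" "v = wo_rel.minim R (candidates \<delta>)"
    using entry_step[OF \<open>v \<in> V\<close>] by metis
  moreover obtain \<delta>' where "entry w = osuc \<delta>'" "w = wo_rel.minim R (candidates \<delta>')"
    using entry_step[OF \<open>w \<in> V\<close>] by metis
  ultimately show "v = w"
    using eq by (simp add: osuc_inject)
qed

lemma algorithmic_traversal_eq:
  "algorithmic_traversal V E R = {(v, w) \<in> V \<times> V. entry v \<le> entry w}"
  using inj_entry by (auto simp: algorithmic_traversal_def inj_on_def order_le_less)

lemma algorithmic_well_order: "well_order_on V (algorithmic_traversal V E R)"
  unfolding algorithmic_traversal_eq using inj_entry by (rule well_order_on_pullback)

lemma algorithmic_wellordered_traversal:
  "wellordered_traversal V E (algorithmic_traversal V E R)"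
proof -
  let ?A = "algorithmic_traversal V E R"
  have "induces_connected E I" if I: "ofilter ?A I" for I
  proof (cases "I = V")
    case True
    then show ?thesis using V_connected by simp
  next
    case False
    have IV: "I \<subseteq> V"
      using I well_order_on_Well_order[OF algorithmic_well_order] by (simp add: ofilter_def)
    have down: "w \<in> I" if "v \<in> I" "w \<in> V" "entry w \<le> entry v" for v w
      using I that IV unfolding ofilter_def under_def algorithmic_traversal_eq by blast
    obtain v where v: "v \<in> V - I" "\<And>w. w \<in> V - I \<Longrightarrow> entry v \<le> entry w"
    proof -
      have "\<exists>\<alpha>. \<exists>v\<in>V - I. entry v = \<alpha>"
        using False IV by blast
      then obtain v where "v \<in> V - I" "entry v = (LEAST \<alpha>. \<exists>v\<in>V - I. entry v = \<alpha>)"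
        by (rule LeastI_ex[THEN bexE]) blast
      then show thesis
        using that by (metis (mono_tags, lifting) Least_le)
    qed
    have "I = {w \<in> V. entry w < entry v}"
      using v down IV by (force simp: not_le[symmetric])
    moreover obtain \<delta> where "stage \<delta> = {w \<in> V. entry w < entry v}"
      using entry_step v(1) by (metis DiffD1)
    ultimately show ?thesis
      using stage_connected by metis
  qed
  then show ?thesis
    using algorithmic_well_order
    by (simp add: wellordered_traversal_def traversal_def well_order_on_def)
qed

text \<open>
  The segment before \<open>t \<beta>\<close> is the stage at which the search chose \<open>t \<beta>\<close> as the \<open>R\<close>-least
  candidate.
\<close>

lemma algorithmic_next_least:
  assumes e: "enumerates V (algorithmic_traversal V E R) \<alpha> t" and "\<beta> < \<alpha>"
    and u: "u \<in> search_candidates V E (t ` {..<\<beta>})"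
  shows "(t \<beta>, u) \<in> R"
proof -
  have V: "t \<beta> \<in> V"
    using assms by (auto simp: enumerates_def bij_betw_def)
  obtain \<delta> where \<delta>: "t \<beta> = wo_rel.minim R (candidates \<delta>)"
      "stage \<delta> = {w \<in> V. entry w < entry (t \<beta>)}"
    using entry_step[OF V] by metis
  have "t ` {..<\<beta>} = stage \<delta>"
    unfolding \<delta>(2) enumeration_segment[OF assms(1,2)] using V
    by (auto simp: algorithmic_traversal_eq)
  then show ?thesis
    using u \<delta>(1) minim_le_candidate search_candidates_subset by (metis Diff_subset subset_trans)
qed

lemma algorithmic_lex_prior:
  assumes T: "wellordered_traversal V E T" and ne: "T \<noteq> algorithmic_traversal V E R"
  shows "lex_prior V R (algorithmic_traversal V E R) T"
proof -
  let ?A = "algorithmic_traversal V E R"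
  have wo: "well_order_on V T"
    using T by (simp add: wellordered_traversal_def)
  obtain \<alpha>\<^sub>1 t\<^sub>1 where e1: "enumerates V ?A \<alpha>\<^sub>1 t\<^sub>1"
    using enumeration_exists[OF algorithmic_well_order] by blast
  obtain \<alpha>\<^sub>2 t\<^sub>2 where e2: "enumerates V T \<alpha>\<^sub>2 t\<^sub>2"
    using enumeration_exists[OF wo] by blast
  have sub: "?A \<subseteq> V \<times> V" "T \<subseteq> V \<times> V"
    using wo well_order_on_domain by (fastforce simp: algorithmic_traversal_def)+
  obtain \<beta> where \<beta>: "\<beta> < \<alpha>\<^sub>1" "\<beta> < \<alpha>\<^sub>2" "\<And>\<gamma>. \<gamma> < \<beta> \<Longrightarrow> t\<^sub>1 \<gamma> = t\<^sub>2 \<gamma>" "t\<^sub>1 \<beta> \<noteq> t\<^sub>2 \<beta>"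
    using first_difference[OF e1 e2 sub ne[symmetric]] by metis
  have "t\<^sub>1 ` {..<\<beta>} = t\<^sub>2 ` {..<\<beta>}"
    using \<beta>(3) by (intro image_cong) auto
  then have "(t\<^sub>1 \<beta>, t\<^sub>2 \<beta>) \<in> R"
    using algorithmic_next_least[OF e1 \<beta>(1)] traversal_next_candidate[OF T e2 \<beta>(2)] by simp
  then show ?thesis
    unfolding lex_prior_def using e1 e2 \<beta> by blast
qed

end

theorem proposition4p1:
  fixes V :: "'a set" and E R :: "'a rel"
  assumes "wellordered_connected_graph V E R"
    and "V \<noteq> {}"
  shows "wellordered_traversal V E (algorithmic_traversal V E R) \<and>
    (\<forall>T. wellordered_traversal V E T \<and> T \<noteq> algorithmic_traversal V E R \<longrightarrow>
      lex_prior V R (algorithmic_traversal V E R) T)"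
proof -
  interpret search_graph V E R
    using assms by (rule search_graph.intro)
  show ?thesis
    using algorithmic_wellordered_traversal algorithmic_lex_prior by blast
qed

end
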